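(* Let $\Gamma=(V,E)$ be a finite simple graph, let $G=G_V$ be the right-angled Artin group based on $\Gamma$, and let $X_V$ be its standard generating set (in bijection with $V$). If $G$ is not free abelian, then $\mathrm{cr}_{X_V}(G)=0$; if $G$ is free abelian, then $\mathrm{cr}_{X_V}(G)=1$.
   Context: For a group $G$ with finite generating set $X$, $\mathbb{B}_{G,X}(n)$ is the ball of radius $n$ about the identity for the word length over $X\cup X^{-1}$, and $C_{G,X}(n)$ is the set of conjugacy classes of $G$ having a representative in $\mathbb{B}_{G,X}(n)$. The conjugacy ratio is $\mathrm{cr}_X(G)=\limsup_{n\to\infty}\frac{|C_{G,X}(n)|}{|\mathbb{B}_{G,X}(n)|}$. A simple graph is non-oriented, without loops or multiple edges. The right-angled Artin group based on $\Gamma=(V,E)$ is the group generated by $X_V=\{x_v : v\in V\}$ subject to the relations $x_vx_w=x_wx_v$ for every edge $\{v,w\}\in E$ (the graph product of copies of $\mathbb{Z}$ over $\Gamma$). *)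

theory Defs
  imports
    "HOL-Algebra.Free_Abelian_Groups"
    "HOL-Algebra.Generated_Groups"
    "HOL-Algebra.Group_Action"
    "HOL-Library.Extended_Nat"
    "HOL-Library.Extended_Real"
    "HOL-Library.Liminf_Limsup"
begin

section \<open>Finite simple graphs\<close>

definition finite_simple_graph :: "'v set \<Rightarrow> 'v set set \<Rightarrow> bool" where
  "finite_simple_graph V E \<longleftrightarrow> finite V \<and> (\<forall>e\<in>E. e \<subseteq> V \<and> card e = 2)"

section \<open>Groups given by generators and relations\<close>

text \<open>The letter \<open>(x, False)\<close> stands for the generator \<open>x\<close>, the letter \<open>(x, True)\<close> for its
  formal inverse.\<close>

type_synonym 'x word = "('x \<times> bool) list"

definition words :: "'x set \<Rightarrow> 'x word set" where
  "words X = lists (X \<times> UNIV)"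

text \<open>A relation \<open>l = r\<close> between words is given as the pair \<open>(l, r)\<close>. The inductive set below is
  the smallest congruence on the words over \<open>X\<close> and its formal inverses which contains the given
  relations and the free cancellations.\<close>

inductive_set word_cong :: "'x set \<Rightarrow> ('x word \<times> 'x word) set \<Rightarrow> ('x word \<times> 'x word) set"
  for X :: "'x set" and R :: "('x word \<times> 'x word) set" where
  refl: "w \<in> words X \<Longrightarrow> (w, w) \<in> word_cong X R"
| sym: "(v, w) \<in> word_cong X R \<Longrightarrow> (w, v) \<in> word_cong X R"
| trans: "(u, v) \<in> word_cong X R \<Longrightarrow> (v, w) \<in> word_cong X R \<Longrightarrow> (u, w) \<in> word_cong X R"
| cancel: "u \<in> words X \<Longrightarrow> v \<in> words X \<Longrightarrow> x \<in> X
    \<Longrightarrow> (u @ [(x, b), (x, \<not> b)] @ v, u @ v) \<in> word_cong X R"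
| rel: "u \<in> words X \<Longrightarrow> v \<in> words X \<Longrightarrow> l \<in> words X \<Longrightarrow> r \<in> words X \<Longrightarrow> (l, r) \<in> R
    \<Longrightarrow> (u @ l @ v, u @ r @ v) \<in> word_cong X R"

definition presented_group :: "'x set \<Rightarrow> ('x word \<times> 'x word) set \<Rightarrow> 'x word set monoid" where
  "presented_group X R =
    \<lparr>carrier = words X // word_cong X R,
     monoid.mult = (\<lambda>A B. \<Union>a\<in>A. \<Union>b\<in>B. word_cong X R `` {a @ b}),
     one = word_cong X R `` {[]}\<rparr>"

definition presented_gen :: "'x set \<Rightarrow> ('x word \<times> 'x word) set \<Rightarrow> 'x \<Rightarrow> 'x word set" where
  "presented_gen X R x = word_cong X R `` {[(x, False)]}"

section \<open>Right-angled Artin groups\<close>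

definition raag_relations :: "'v set set \<Rightarrow> ('v word \<times> 'v word) set" where
  "raag_relations E =
    {([(v, False), (w, False)], [(w, False), (v, False)]) | v w. {v, w} \<in> E}"

definition raag :: "'v set \<Rightarrow> 'v set set \<Rightarrow> 'v word set monoid" where
  "raag V E = presented_group V (raag_relations E)"

definition raag_generators :: "'v set \<Rightarrow> 'v set set \<Rightarrow> 'v word set set" where
  "raag_generators V E = presented_gen V (raag_relations E) ` V"

section \<open>Free abelian groups\<close>

text \<open>A basis of a free abelian group is a subset of the group, so it is no restriction to let \<open>S\<close>
  range over sets of elements of the carrier type. The rank \<open>0\<close> is allowed.\<close>

definition free_abelian :: "'g monoid \<Rightarrow> bool" where
  "free_abelian G \<longleftrightarrow> (\<exists>S :: 'g set. G \<cong> free_Abelian_group S)"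

section \<open>The conjugacy ratio\<close>

text \<open>The value is \<open>\<infinity>\<close> for an element outside the subgroup generated by \<open>X\<close>.\<close>

definition word_length :: "('g, 'm) monoid_scheme \<Rightarrow> 'g set \<Rightarrow> 'g \<Rightarrow> enat" where
  "word_length G X g =
    (INF ws \<in> {ws. set ws \<subseteq> X \<union> m_inv G ` X \<and> foldr (\<otimes>\<^bsub>G\<^esub>) ws \<one>\<^bsub>G\<^esub> = g}. enat (length ws))"

definition word_ball :: "('g, 'm) monoid_scheme \<Rightarrow> 'g set \<Rightarrow> nat \<Rightarrow> 'g set" where
  "word_ball G X n = {g \<in> carrier G. word_length G X g \<le> enat n}"

definition conjugacy_classes :: "('g, 'm) monoid_scheme \<Rightarrow> 'g set set" where
  "conjugacy_classes G =
    orbits G (carrier G) (\<lambda>g. \<lambda>h \<in> carrier G. g \<otimes>\<^bsub>G\<^esub> h \<otimes>\<^bsub>G\<^esub> inv\<^bsub>G\<^esub> g)"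

definition ball_conjugacy_classes ::
    "('g, 'm) monoid_scheme \<Rightarrow> 'g set \<Rightarrow> nat \<Rightarrow> 'g set set" where
  "ball_conjugacy_classes G X n = {C \<in> conjugacy_classes G. C \<inter> word_ball G X n \<noteq> {}}"

definition conjugacy_ratio :: "('g, 'm) monoid_scheme \<Rightarrow> 'g set \<Rightarrow> ereal" where
  "conjugacy_ratio G X =
    limsup (\<lambda>n. ereal (real (card (ball_conjugacy_classes G X n)) / real (card (word_ball G X n))))"

section \<open>Basic facts\<close>

lemma words_Nil [simp]: "[] \<in> words X"
  and words_append [simp]: "u @ v \<in> words X \<longleftrightarrow> u \<in> words X \<and> v \<in> words X"
  and words_Cons [simp]: "(a # u) \<in> words X \<longleftrightarrow> fst a \<in> X \<and> u \<in> words X"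
  by (auto simp: words_def mem_Times_iff)

lemma word_cong_words: "(u, v) \<in> word_cong X R \<Longrightarrow> u \<in> words X \<and> v \<in> words X"
  by (induction rule: word_cong.induct) auto

lemma equiv_word_cong: "equiv (words X) (word_cong X R)"
proof (rule equivI)
  show "word_cong X R \<subseteq> words X \<times> words X"
    using word_cong_words by fastforce
qed (auto intro!: refl_onI symI transI intro: word_cong.refl word_cong.sym word_cong.trans)

lemma word_cong_context:
  assumes "(u, v) \<in> word_cong X R" "p \<in> words X" "q \<in> words X"
  shows "(p @ u @ q, p @ v @ q) \<in> word_cong X R"
  using assms
proof (induction rule: word_cong.induct)
  case (cancel u v x b)
  then show ?case
    using word_cong.cancel[of "p @ u" X "v @ q" x b R] by simp
next
  case (rel u v l r)
  then show ?case
    using word_cong.rel[of "p @ u" X "v @ q" l r R] by simp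
qed (auto intro: word_cong.refl word_cong.sym word_cong.trans)

lemma word_cong_append:
  assumes "(u, u') \<in> word_cong X R" "(v, v') \<in> word_cong X R"
  shows "(u @ v, u' @ v') \<in> word_cong X R"
proof -
  have "(u @ v, u' @ v) \<in> word_cong X R"
    using word_cong_context[OF assms(1), of "[]" v] word_cong_words[OF assms(2)] by simp
  moreover have "(u' @ v, u' @ v') \<in> word_cong X R"
    using word_cong_context[OF assms(2), of u' "[]"] word_cong_words[OF assms(1)] by simp
  ultimately show ?thesis
    by (rule word_cong.trans)
qed

lemma carrier_presented_group: "carrier (presented_group X R) = words X // word_cong X R"
  and one_presented_group: "\<one>\<^bsub>presented_group X R\<^esub> = word_cong X R `` {[]}"
  by (simp_all add: presented_group_def)

lemma mult_presented_group:
  assumes "u \<in> words X" "v \<in> words X"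
  shows "word_cong X R `` {u} \<otimes>\<^bsub>presented_group X R\<^esub> word_cong X R `` {v}
    = word_cong X R `` {u @ v}"
proof -
  have "congruent2 (word_cong X R) (word_cong X R) (\<lambda>a b. word_cong X R `` {a @ b})"
    by (intro congruent2I' equiv_class_eq[OF equiv_word_cong] word_cong_append)
  from UN_equiv_class2[OF equiv_word_cong equiv_word_cong this assms] show ?thesis
    by (simp add: presented_group_def)
qed

definition inv_word :: "'x word \<Rightarrow> 'x word" where
  "inv_word w = rev (map (\<lambda>(x, b). (x, \<not> b)) w)"

lemma inv_word_in_words [simp]: "inv_word w \<in> words X \<longleftrightarrow> w \<in> words X"
  by (induction w) (auto simp: inv_word_def)

lemma inv_word_cancel: "w \<in> words X \<Longrightarrow> (inv_word w @ w, []) \<in> word_cong X R"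
proof (induction w)
  case Nil
  then show ?case
    by (simp add: inv_word_def word_cong.refl)
next
  case (Cons a w)
  obtain x b where a: "a = (x, b)"
    by (cases a)
  have "(inv_word w @ [(x, \<not> b), (x, \<not> \<not> b)] @ w, inv_word w @ w) \<in> word_cong X R"
    using Cons.prems a by (intro word_cong.cancel) auto
  moreover have "inv_word (a # w) @ (a # w) = inv_word w @ [(x, \<not> b), (x, \<not> \<not> b)] @ w"
    by (simp add: inv_word_def a)
  ultimately show ?case
    using Cons by (metis words_Cons word_cong.trans)
qed

lemma group_presented_group: "group (presented_group X R)"
proof (rule groupI)
  fix A B assume "A \<in> carrier (presented_group X R)" "B \<in> carrier (presented_group X R)"
  then obtain u v where "u \<in> words X" "v \<in> words X" "A = word_cong X R `` {u}" "B = word_cong X R `` {v}"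
    by (auto simp: carrier_presented_group elim!: quotientE)
  then show "A \<otimes>\<^bsub>presented_group X R\<^esub> B \<in> carrier (presented_group X R)"
    by (simp add: mult_presented_group) (simp add: carrier_presented_group quotientI)
next
  fix A B C
  assume "A \<in> carrier (presented_group X R)" "B \<in> carrier (presented_group X R)"
    "C \<in> carrier (presented_group X R)"
  then obtain u v w where "u \<in> words X" "v \<in> words X" "w \<in> words X"
    "A = word_cong X R `` {u}" "B = word_cong X R `` {v}" "C = word_cong X R `` {w}"
    by (auto simp: carrier_presented_group elim!: quotientE)
  then show "A \<otimes>\<^bsub>presented_group X R\<^esub> B \<otimes>\<^bsub>presented_group X R\<^esub> C
      = A \<otimes>\<^bsub>presented_group X R\<^esub> (B \<otimes>\<^bsub>presented_group X R\<^esub> C)"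
    by (simp add: mult_presented_group)
next
  fix A assume "A \<in> carrier (presented_group X R)"
  then obtain u where u: "u \<in> words X" "A = word_cong X R `` {u}"
    by (auto simp: carrier_presented_group elim!: quotientE)
  then show "\<one>\<^bsub>presented_group X R\<^esub> \<otimes>\<^bsub>presented_group X R\<^esub> A = A"
    by (simp add: one_presented_group mult_presented_group)
  show "\<exists>B\<in>carrier (presented_group X R). B \<otimes>\<^bsub>presented_group X R\<^esub> A = \<one>\<^bsub>presented_group X R\<^esub>"
  proof
    show "word_cong X R `` {inv_word u} \<otimes>\<^bsub>presented_group X R\<^esub> A = \<one>\<^bsub>presented_group X R\<^esub>"
      using u by (auto simp: one_presented_group mult_presented_group
          intro!: equiv_class_eq[OF equiv_word_cong] inv_word_cancel)
  qed (use u in \<open>simp add: carrier_presented_group quotientI\<close>)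
qed (simp add: carrier_presented_group one_presented_group quotientI)

lemma group_raag: "group (raag V E)"
  by (simp add: raag_def group_presented_group)

lemma word_ball_eq:
  assumes "group G" "X \<subseteq> carrier G"
  shows "word_ball G X n =
    {foldr (\<otimes>\<^bsub>G\<^esub>) ws \<one>\<^bsub>G\<^esub> | ws. set ws \<subseteq> X \<union> m_inv G ` X \<and> length ws \<le> n}"
proof -
  interpret group G by fact
  have closed: "foldr (\<otimes>\<^bsub>G\<^esub>) ws \<one>\<^bsub>G\<^esub> \<in> carrier G" if "set ws \<subseteq> X \<union> m_inv G ` X" for ws
    using that assms(2) by (induction ws) auto
  have "\<exists>ws. set ws \<subseteq> X \<union> m_inv G ` X \<and> foldr (\<otimes>\<^bsub>G\<^esub>) ws \<one>\<^bsub>G\<^esub> = g \<and> length ws \<le> n"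
    if "word_length G X g \<le> enat n" for g
  proof -
    define W where
      "W = {ws. set ws \<subseteq> X \<union> m_inv G ` X \<and> foldr (\<otimes>\<^bsub>G\<^esub>) ws \<one>\<^bsub>G\<^esub> = g}"
    have len: "word_length G X g = Inf ((\<lambda>ws. enat (length ws)) ` W)"
      by (simp add: word_length_def W_def)
    have "W \<noteq> {}"
      using that unfolding len by (auto simp: Inf_enat_def)
    then obtain ws0 where "ws0 \<in> W"
      by blast
    then have "word_length G X g \<in> (\<lambda>ws. enat (length ws)) ` W"
      unfolding len by (intro wellorder_InfI[OF imageI])
    then obtain ws where "ws \<in> W" "word_length G X g = enat (length ws)"
      by blast
    then have "set ws \<subseteq> X \<union> m_inv G ` X" "foldr (\<otimes>\<^bsub>G\<^esub>) ws \<one>\<^bsub>G\<^esub> = g"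
      "word_length G X g = enat (length ws)"
      by (simp_all add: W_def)
    with that show ?thesis by auto
  qed
  moreover have "word_length G X (foldr (\<otimes>\<^bsub>G\<^esub>) ws \<one>\<^bsub>G\<^esub>) \<le> enat n"
    if "set ws \<subseteq> X \<union> m_inv G ` X" "length ws \<le> n" for ws
    unfolding word_length_def using that by (intro INF_lower2[of ws]) auto
  ultimately show ?thesis
    unfolding word_ball_def using closed by blast
qed

lemma presented_gen_carrier: "x \<in> X \<Longrightarrow> presented_gen X R x \<in> carrier (presented_group X R)"
  by (simp add: presented_gen_def carrier_presented_group quotientI)

lemma inv_presented_gen:
  assumes "x \<in> X"
  shows "inv\<^bsub>presented_group X R\<^esub> presented_gen X R x = word_cong X R `` {[(x, True)]}"
proof -
  interpret group "presented_group X R" by (rule group_presented_group)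
  have "([(x, True), (x, False)], []) \<in> word_cong X R"
    using word_cong.cancel[of "[]" X "[]" x True R] assms by simp
  then show ?thesis
    using assms
    by (intro inv_equality)
      (auto simp: presented_gen_def mult_presented_group one_presented_group
        carrier_presented_group quotientI intro!: equiv_class_eq[OF equiv_word_cong])
qed

lemma generate_presented_gen:
  "generate (presented_group X R) (presented_gen X R ` X) = carrier (presented_group X R)"
proof
  interpret group "presented_group X R" by (rule group_presented_group)
  show "generate (presented_group X R) (presented_gen X R ` X) \<subseteq> carrier (presented_group X R)"
    by (intro generate_incl) (auto simp: presented_gen_carrier)
  have "word_cong X R `` {u} \<in> generate (presented_group X R) (presented_gen X R ` X)"
    if "u \<in> words X" for u
    using that
  proof (induction u)
    case Nil
    then show ?case
      using generate.one[of "presented_group X R"] by (simp add: one_presented_group)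
  next
    case (Cons a u)
    obtain x b where a: "a = (x, b)" "x \<in> X"
      using Cons.prems by (cases a) auto
    have "word_cong X R `` {[a]} \<in> generate (presented_group X R) (presented_gen X R ` X)"
    proof (cases b)
      case True
      then show ?thesis
        using a inv_presented_gen[of x X R]
          generate.inv[of "presented_gen X R x" "presented_gen X R ` X" "presented_group X R"]
        by simp
    next
      case False
      then show ?thesis
        using a
          generate.incl[of "presented_gen X R x" "presented_gen X R ` X" "presented_group X R"]
        by (simp add: presented_gen_def)
    qed
    with Cons have "word_cong X R `` {[a]} \<otimes>\<^bsub>presented_group X R\<^esub> word_cong X R `` {u}
        \<in> generate (presented_group X R) (presented_gen X R ` X)"
      by (intro generate.eng) auto
    then show ?case
      using Cons.prems mult_presented_group[of "[a]" X u R] by simp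
  qed
  then show "carrier (presented_group X R) \<subseteq> generate (presented_group X R) (presented_gen X R ` X)"
    by (auto simp: carrier_presented_group elim!: quotientE)
qed

text \<open>The exponent sum of a generator is invariant under the relations of a right-angled Artin
  group. Hence distinct vertices give distinct standard generators.\<close>

lemma raag_generators_bij: "bij_betw (presented_gen V (raag_relations E)) V (raag_generators V E)"
proof -
  define s :: "'a \<Rightarrow> 'a word \<Rightarrow> int" where
    "s x w = (\<Sum>a\<leftarrow>w. if fst a = x then (if snd a then -1 else 1) else 0)" for x w
  have inv: "s x u = s x v" if "(u, v) \<in> word_cong V (raag_relations E)" for x u v
    using that by (induction rule: word_cong.induct) (auto simp: s_def raag_relations_def)
  have "x = y" if "x \<in> V" "y \<in> V"
    "presented_gen V (raag_relations E) x = presented_gen V (raag_relations E) y" for x y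
  proof -
    have "([(x, False)], [(y, False)]) \<in> word_cong V (raag_relations E)"
      using that eq_equiv_class[OF _ equiv_word_cong, of V _ "[(x, False)]" "[(y, False)]"]
      by (simp add: presented_gen_def)
    from inv[OF this, of x] show ?thesis
      by (simp add: s_def split: if_splits)
  qed
  then show ?thesis
    unfolding raag_generators_def by (intro inj_on_imp_bij_betw inj_onI)
qed

end

theory Submission
  imports Defs "HOL-Real_Asymp.Real_Asymp"
begin

text \<open>Suppose two generators do not commute, so that balls grow exponentially, and fix \<open>k\<close>. The
  classes meeting the ball \<open>B(n)\<close> in at least \<open>k\<close> elements number at most \<open>|B(n)| / k\<close>. Let \<open>w\<close> be a
  word of minimal length representing an element of a class that meets \<open>B(n)\<close> in fewer than \<open>k\<close>
  elements. All cyclic shifts of \<open>w\<close> are geodesic and represent elements of that class in \<open>B(n)\<close>, and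
  geodesic words representing the same element have the same projections to any two equal or
  nonadjacent vertices. Hence each such projection of \<open>w\<close> has fewer than \<open>k\<close> distinct cyclic shifts,
  so it is periodic with period less than \<open>k\<close>. There are only linearly many such projections, and
  they determine the class, so the classes of this second kind are polynomially many in \<open>n\<close>.\<close>

section \<open>Reduced words\<close>

text \<open>\<open>E\<close> is an arbitrary set of sets in most lemmas, so
  \<open>x \<noteq> y\<close> is built in: a singleton in \<open>E\<close> must not make a vertex
  adjacent to itself. Irreflexivity also puts the single-vertex projections \<open>proj x x\<close>
  among those that \<open>trace_eq\<close> compares.\<close>

definition adj :: "'v set set \<Rightarrow> 'v \<Rightarrow> 'v \<Rightarrow> bool" where
  "adj E x y \<longleftrightarrow> x \<noteq> y \<and> {x, y} \<in> E"

definition proj :: "'v \<Rightarrow> 'v \<Rightarrow> 'v word \<Rightarrow> 'v word" where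
  "proj x y w = filter (\<lambda>a. fst a = x \<or> fst a = y) w"

text \<open>Words agree in all these projections iff they differ by commutations of adjacent letters.\<close>

definition trace_eq :: "'v set set \<Rightarrow> 'v word \<Rightarrow> 'v word \<Rightarrow> bool" where
  "trace_eq E u v \<longleftrightarrow> (\<forall>x y. \<not> adj E x y \<longrightarrow> proj x y u = proj x y v)"

definition inv_letter :: "'v \<times> bool \<Rightarrow> 'v \<times> bool" where
  "inv_letter a = (fst a, \<not> snd a)"

text \<open>Commutations bring this occurrence of \<open>c\<close> to the front. Since
  \<open>adj\<close> is irreflexive, \<open>u\<close> has no letter on the vertex of
  \<open>c\<close>, so the occurrence is the first letter on that vertex.\<close>

definition initial :: "'v set set \<Rightarrow> 'v \<times> bool \<Rightarrow> 'v word \<Rightarrow> bool" where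
  "initial E c w \<longleftrightarrow> (\<exists>u z. w = u @ c # z \<and> (\<forall>d\<in>set u. adj E (fst c) (fst d)))"

text \<open>Left multiplication by a letter on reduced words. It is well defined up to \<open>trace_eq\<close> on group
  elements, which replaces a confluence argument for the normal form.\<close>

definition push :: "'v set set \<Rightarrow> 'v \<times> bool \<Rightarrow> 'v word \<Rightarrow> 'v word" where
  "push E a w = (if initial E (inv_letter a) w then remove1 (inv_letter a) w else a # w)"

definition reduce :: "'v set set \<Rightarrow> 'v word \<Rightarrow> 'v word" where
  "reduce E w = foldr (push E) w []"

text \<open>Excluded are pairs of inverse letters that commutations could bring together and
  cancel.\<close>

definition reduced :: "'v set set \<Rightarrow> 'v word \<Rightarrow> bool" where
  "reduced E w \<longleftrightarrow> (\<forall>u a v z. w = u @ a # v @ inv_letter a # z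
     \<longrightarrow> \<not> (\<forall>d\<in>set v. adj E (fst a) (fst d)))"

section \<open>Projections and trace equivalence\<close>

lemma adj_irrefl [simp]: "\<not> adj E x x"
  by (simp add: adj_def)

lemma adj_sym: "adj E x y \<longleftrightarrow> adj E y x"
  by (auto simp: adj_def insert_commute)

lemma fst_inv_letter [simp]: "fst (inv_letter a) = fst a"
  and inv_letter_inv_letter [simp]: "inv_letter (inv_letter a) = a"
  by (simp_all add: inv_letter_def)

lemma proj_append [simp]: "proj x y (u @ v) = proj x y u @ proj x y v"
  and proj_Nil [simp]: "proj x y [] = []"
  and proj_Cons: "proj x y (a # w) = (if fst a = x \<or> fst a = y then a # proj x y w else proj x y w)"
  by (simp_all add: proj_def)

lemma proj_commute: "proj x y w = proj y x w"
  by (simp add: proj_def disj_commute)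

lemma trace_eq_refl [simp]: "trace_eq E u u"
  by (simp add: trace_eq_def)

lemma trace_eq_sym: "trace_eq E u v \<Longrightarrow> trace_eq E v u"
  by (simp add: trace_eq_def)

lemma trace_eq_trans: "trace_eq E u v \<Longrightarrow> trace_eq E v w \<Longrightarrow> trace_eq E u w"
  by (simp add: trace_eq_def)

lemma proj_all_adj:
  assumes "\<forall>d\<in>set u. adj E x (fst d)" "\<not> adj E x y"
  shows "proj x y u = []"
  using assms by (auto simp: proj_def filter_empty_conv)

text \<open>Being initial is visible in the projections alone, hence invariant under
  \<open>trace_eq\<close>. The projection to the single vertex of \<open>c\<close> locates the
  occurrence, and the projections to pairs rule out nonadjacent letters before it.\<close>

lemma initial_iff: "initial E c w \<longleftrightarrow> (\<forall>y. \<not> adj E (fst c) y \<longrightarrow> (\<exists>t. proj (fst c) y w = c # t))"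
proof
  assume "initial E c w"
  then show "\<forall>y. \<not> adj E (fst c) y \<longrightarrow> (\<exists>t. proj (fst c) y w = c # t)"
    by (auto simp: initial_def proj_all_adj proj_Cons)
next
  assume R: "\<forall>y. \<not> adj E (fst c) y \<longrightarrow> (\<exists>t. proj (fst c) y w = c # t)"
  then obtain t where "proj (fst c) (fst c) w = c # t"
    by force
  then obtain u z where w: "w = u @ c # z" and u: "\<forall>d\<in>set u. fst d \<noteq> fst c"
    by (auto simp: proj_def filter_eq_Cons_iff)
  have "adj E (fst c) (fst d)" if "d \<in> set u" for d
  proof (rule ccontr)
    assume "\<not> adj E (fst c) (fst d)"
    with R obtain t where t: "proj (fst c) (fst d) w = c # t"
      by blast
    \<comment> \<open>The projection of \<open>u\<close> is nonempty and starts the one of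
      \<open>w\<close>, so its head would be \<open>c\<close>; but \<open>u\<close> has no letter on
      the vertex of \<open>c\<close>.\<close>
    have "d \<in> set (proj (fst c) (fst d) u)"
      using that by (simp add: proj_def)
    then obtain e s where "proj (fst c) (fst d) u = e # s"
      by (cases "proj (fst c) (fst d) u") auto
    moreover from this have "e \<in> set u"
      by (auto simp: proj_def filter_eq_Cons_iff)
    ultimately show False
      using t u w by auto
  qed
  with w show "initial E c w"
    by (auto simp: initial_def)
qed

section \<open>The effect of \<open>push\<close> on projections\<close>

lemma remove1_initial:
  assumes "\<forall>d\<in>set u. adj E (fst c) (fst d)"
  shows "remove1 c (u @ c # z) = u @ z"
  using assms by (auto simp: remove1_append)

text \<open>A nonadjacent pair containing the vertex of \<open>c\<close> sees no letter of
  \<open>u\<close>, so \<open>c\<close> heads that projection and deleting it is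
  \<open>tl\<close>.\<close>

lemma proj_remove1:
  assumes "initial E c w" "\<not> adj E x y"
  shows "proj x y (remove1 c w) = (if fst c = x \<or> fst c = y then tl (proj x y w) else proj x y w)"
proof -
  obtain u z where w: "w = u @ c # z" and u: "\<forall>d\<in>set u. adj E (fst c) (fst d)"
    using assms(1) by (auto simp: initial_def)
  have "proj x y u = []" if "fst c = x \<or> fst c = y"
    using that proj_all_adj[OF u] assms(2) by (metis adj_sym proj_commute)
  then show ?thesis
    using u by (auto simp: w remove1_initial proj_Cons)
qed

text \<open>\<open>push\<close> acts on each projection by \<open>tl\<close>, by a cons or not at
  all, so identities up to \<open>trace_eq\<close> become identities of lists once the relevant
  \<open>initial\<close> conditions are compared.\<close>

lemma proj_push:
  assumes "\<not> adj E x y"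
  shows "proj x y (push E a w) =
    (if fst a = x \<or> fst a = y
     then if initial E (inv_letter a) w then tl (proj x y w) else a # proj x y w
     else proj x y w)"
  using assms by (simp add: push_def proj_remove1 proj_Cons)

lemma initial_cong: "trace_eq E u v \<Longrightarrow> initial E c u \<longleftrightarrow> initial E c v"
  by (auto simp: initial_iff trace_eq_def)

lemma push_cong: "trace_eq E u v \<Longrightarrow> trace_eq E (push E a u) (push E a v)"
  using initial_cong by (fastforce simp: trace_eq_def proj_push)

text \<open>The vertex of \<open>b\<close> is adjacent to that of \<open>c\<close>, so it occurs in
  no nonadjacent pair containing the latter, and the projections that decide \<open>initial\<close>
  do not change.\<close>

lemma initial_push_adj:
  assumes "adj E (fst a) (fst b)" "fst c = fst a"
  shows "initial E c (push E b w) \<longleftrightarrow> initial E c w"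
proof -
  have "proj (fst c) y (push E b w) = proj (fst c) y w" if "\<not> adj E (fst c) y" for y
    using assms that by (auto simp: proj_push)
  then show ?thesis
    by (simp add: initial_iff)
qed

lemma push_commute:
  assumes "adj E (fst a) (fst b)"
  shows "trace_eq E (push E a (push E b w)) (push E b (push E a w))"
proof -
  have "initial E (inv_letter a) (push E b w) \<longleftrightarrow> initial E (inv_letter a) w"
    "initial E (inv_letter b) (push E a w) \<longleftrightarrow> initial E (inv_letter b) w"
    using assms by (simp_all add: initial_push_adj[of E a b] initial_push_adj[of E b a] adj_sym)
  \<comment> \<open>No nonadjacent pair contains both vertices, so at most one of the two pushes
    touches a given projection.\<close>
  moreover have "\<not> ((fst a = x \<or> fst a = y) \<and> (fst b = x \<or> fst b = y))" if "\<not> adj E x y" for x y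
    using assms that by (auto simp: adj_sym)
  ultimately show ?thesis
    by (auto simp: trace_eq_def proj_push)
qed

text \<open>If \<open>push\<close> cancels, a forbidden pair in \<open>u @ z\<close> would give one
  in \<open>w\<close> by putting \<open>inv_letter a\<close> back at the cut. Where the cut falls
  between the two letters of the pair, the first of them lies in \<open>u\<close>, hence is adjacent
  to \<open>a\<close>, so \<open>inv_letter a\<close> may join the gap. If \<open>push\<close>
  prepends, a new pair must begin with \<open>a\<close> and would make \<open>inv_letter a\<close>
  initial.\<close>

lemma reduced_push:
  assumes "reduced E w"
  shows "reduced E (push E a w)"
proof (cases "initial E (inv_letter a) w")
  case True
  then obtain u z where w: "w = u @ inv_letter a # z" and u: "\<forall>d\<in>set u. adj E (fst a) (fst d)"
    by (auto simp: initial_def)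
  have p: "push E a w = u @ z"
    using True u by (simp add: push_def w remove1_initial)
  show ?thesis
    unfolding p reduced_def
  proof (intro allI impI notI)
    fix u' c v z'
    assume eq: "u @ z = u' @ c # v @ inv_letter c # z'" and v: "\<forall>d\<in>set v. adj E (fst c) (fst d)"
    have no: "\<And>u' v z'. w = u' @ c # v @ inv_letter c # z' \<Longrightarrow> \<forall>d\<in>set v. adj E (fst c) (fst d) \<Longrightarrow> False"
      using assms unfolding reduced_def by blast
    \<comment> \<open>The cases compare the pair with the cut between \<open>u\<close> and
      \<open>z\<close>: in \<open>A\<close> the pair lies in \<open>z\<close>; in \<open>B\<close>
      with nonempty \<open>s\<close> its first letter lies in \<open>u\<close>.\<close>
    consider (A) s where "u' = u @ s" "z = s @ c # v @ inv_letter c # z'"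
      | (B) s where "u = u' @ s" "s @ z = c # v @ inv_letter c # z'"
      using eq by (auto simp: append_eq_append_conv2)
    then show False
    proof cases
      case A
      then show False
        using no[of "u @ inv_letter a # s" v z'] v w by simp
    next
      case B
      show False
      proof (cases s)
        case Nil
        then show False
          using no[of "u @ [inv_letter a]" v z'] v w B by simp
      next
        case (Cons e s')
        with B have s': "e = c" "s' @ z = v @ inv_letter c # z'"
          by auto
        with B Cons u have ac: "adj E (fst c) (fst a)"
          by (auto simp: adj_sym)
        consider (C) t where "v = s' @ t" "z = t @ inv_letter c # z'"
          | (D) t where "s' = v @ t" "t @ z = inv_letter c # z'"
          using s'(2) by (auto simp: append_eq_append_conv2)
        then show False
        proof cases
          case C
          then show False
            using no[of u' "s' @ inv_letter a # t" z'] v w B Cons s' ac by auto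
        next
          case D
          show False
          proof (cases t)
            case Nil
            then show False
              using no[of u' "v @ [inv_letter a]" z'] v w B Cons s' D ac by auto
          next
            case (Cons f t')
            then show False
              using no[of u' v "t' @ inv_letter a # z"] v w B \<open>s = e # s'\<close> s' D by auto
          qed
        qed
      qed
    qed
  qed
next
  case False
  then have p: "push E a w = a # w"
    by (simp add: push_def)
  show ?thesis
    unfolding p reduced_def
  proof (intro allI impI)
    fix u c v z
    assume "a # w = u @ c # v @ inv_letter c # z"
    then consider "c = a" "w = v @ inv_letter c # z" | u' where "w = u' @ c # v @ inv_letter c # z"
      by (auto simp: Cons_eq_append_conv)
    then show "\<not> (\<forall>d\<in>set v. adj E (fst c) (fst d))"
    proof cases
      case 1
      then show ?thesis
        using False by (auto simp: initial_def)
    next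
      case 2
      then show ?thesis
        using assms unfolding reduced_def by blast
    qed
  qed
qed

text \<open>On reduced words, inverse letters act by inverse operations up to commutations. If
  \<open>inv_letter a\<close> is prepended, it cancels at once; if instead \<open>a\<close> is
  deleted, reducedness forces the next push to put it back.\<close>

lemma push_push_inv_letter:
  assumes "reduced E w"
  shows "trace_eq E (push E a (push E (inv_letter a) w)) w"
proof (cases "initial E a w")
  case True
  then obtain u z where w: "w = u @ a # z" and u: "\<forall>d\<in>set u. adj E (fst a) (fst d)"
    by (auto simp: initial_def)
  have p: "push E (inv_letter a) w = u @ z"
    using True u by (simp add: push_def w remove1_initial)
  \<comment> \<open>An \<open>inv_letter a\<close> that is initial after the deletion would form,
    with the deleted \<open>a\<close>, a pair forbidden in \<open>w\<close>.\<close>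
  have "\<not> initial E (inv_letter a) (u @ z)"
  proof
    assume "initial E (inv_letter a) (u @ z)"
    then obtain u' z' where eq: "u @ z = u' @ inv_letter a # z'"
      and u': "\<forall>d\<in>set u'. adj E (fst a) (fst d)"
      by (auto simp: initial_def)
    have "inv_letter a \<notin> set u"
      using u by auto
    with eq obtain s where "u' = u @ s" "z = s @ inv_letter a # z'"
      by (auto simp: append_eq_append_conv2 Cons_eq_append_conv append_eq_Cons_conv)
    then have "w = u @ a # s @ inv_letter a # z'" "\<forall>d\<in>set s. adj E (fst a) (fst d)"
      using u' w by auto
    then show False
      using assms unfolding reduced_def by blast
  qed
  then have "push E a (push E (inv_letter a) w) = a # u @ z"
    unfolding p by (simp add: push_def)
  moreover have "proj x y u = []" if "\<not> adj E x y" "fst a = x \<or> fst a = y" for x y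
    using that proj_all_adj[OF u] by (metis adj_sym proj_commute)
  ultimately show ?thesis
    by (auto simp: trace_eq_def w proj_Cons)
next
  case False
  then have "push E (inv_letter a) w = inv_letter a # w"
    by (simp add: push_def)
  moreover have "initial E (inv_letter a) (inv_letter a # w)"
    by (force simp: initial_def)
  ultimately show ?thesis
    by (simp add: push_def)
qed

section \<open>Reduced forms as invariants of group elements\<close>

lemma reduced_reduce: "reduced E (reduce E w)"
  by (induction w) (auto simp: reduce_def reduced_push, simp add: reduced_def)

lemma reduce_append: "reduce E (u @ v) = foldr (push E) u (reduce E v)"
  by (simp add: reduce_def)

lemma foldr_push_cong:
  "trace_eq E u v \<Longrightarrow> trace_eq E (foldr (push E) p u) (foldr (push E) p v)"
  by (induction p) (auto intro: push_cong)

text \<open>Words act on reduced words through \<open>push\<close>. Up to \<open>trace_eq\<close> a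
  free cancellation acts trivially and the two sides of a relation act alike, so the reduced form of
  a group element is unique up to commutations.\<close>

lemma reduce_cong:
  assumes "(u, v) \<in> word_cong V (raag_relations E)"
  shows "trace_eq E (reduce E u) (reduce E v)"
  using assms
proof (induction rule: word_cong.induct)
  case (cancel u v x b)
  have "trace_eq E (push E (x, b) (push E (inv_letter (x, b)) (reduce E v))) (reduce E v)"
    by (intro push_push_inv_letter reduced_reduce)
  then show ?case
    unfolding reduce_append by (intro foldr_push_cong) (simp add: inv_letter_def)
next
  case (rel u v l r)
  then obtain x y where lr: "l = [(x, False), (y, False)]" "r = [(y, False), (x, False)]" "{x, y} \<in> E"
    by (auto simp: raag_relations_def)
  \<comment> \<open>\<open>E\<close> may contain a singleton; then \<open>x = y\<close> and the two
    sides coincide.\<close>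
  have "trace_eq E (foldr (push E) l (reduce E v)) (foldr (push E) r (reduce E v))"
    using push_commute[of E "(x, False)" "(y, False)"] lr by (cases "x = y") (auto simp: adj_def)
  then show ?case
    unfolding reduce_append by (intro foldr_push_cong)
qed (auto intro: trace_eq_sym trace_eq_trans)

lemma length_reduce_le: "length (reduce E w) \<le> length w"
  by (induction w) (auto simp: reduce_def push_def length_remove1)

text \<open>A cancelling \<open>push\<close> yields two letters fewer than a prepending one, so if
  no length is lost, nothing ever cancels.\<close>

lemma reduce_eq_self: "length (reduce E w) = length w \<Longrightarrow> reduce E w = w"
proof (induction w)
  case (Cons a w)
  have "length (reduce E w) \<le> length w"
    by (rule length_reduce_le)
  with Cons show ?case
    by (auto simp: reduce_def push_def length_remove1 split: if_splits)
qed (simp add: reduce_def)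

section \<open>Words representing the same element\<close>

abbreviation raag_cong :: "'v set \<Rightarrow> 'v set set \<Rightarrow> ('v word \<times> 'v word) set" where
  "raag_cong V E \<equiv> word_cong V (raag_relations E)"

lemma raag_cong_cancel:
  assumes "fst a \<in> V"
  shows "([a, inv_letter a], []) \<in> raag_cong V E"
  using word_cong.cancel[of "[]" V "[]" "fst a" "snd a"] assms by (simp add: inv_letter_def)

lemma raag_cong_commute_inv_letter:
  assumes "([a, b], [b, a]) \<in> raag_cong V E"
  shows "([inv_letter a, b], [b, inv_letter a]) \<in> raag_cong V E"
proof -
  have V: "fst a \<in> V" "fst b \<in> V"
    using word_cong_words[OF assms] by auto
  \<comment> \<open>With \<open>i\<close> the inverse of \<open>a\<close>, the chain is
    \<open>i b\<close>, \<open>i b a i\<close>, \<open>i a b i\<close>, \<open>b i\<close>: insert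
    \<open>a i\<close>, commute, cancel \<open>i a\<close>.\<close>
  let ?i = "inv_letter a"
  have "([?i, b] @ [a, ?i] @ [], [?i, b] @ [] @ []) \<in> raag_cong V E"
    using V by (intro word_cong_context raag_cong_cancel) auto
  moreover have "([?i] @ [a, b] @ [?i], [?i] @ [b, a] @ [?i]) \<in> raag_cong V E"
    using V by (intro word_cong_context assms) auto
  moreover have "([] @ [?i, inv_letter ?i] @ [b, ?i], [] @ [] @ [b, ?i]) \<in> raag_cong V E"
    using V by (intro word_cong_context raag_cong_cancel) auto
  ultimately show ?thesis
    by simp (meson word_cong.sym word_cong.trans)
qed

lemma raag_cong_commute:
  assumes "adj E (fst a) (fst b)" "fst a \<in> V" "fst b \<in> V"
  shows "([a, b], [b, a]) \<in> raag_cong V E"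
proof -
  have pos: "([(x, False), (y, False)], [(y, False), (x, False)]) \<in> raag_cong V E"
    if "adj E x y" "x \<in> V" "y \<in> V" for x y
    using that word_cong.rel[of "[]" V "[]" "[(x, False), (y, False)]" "[(y, False), (x, False)]" "raag_relations E"]
    by (auto simp: raag_relations_def adj_def)
  \<comment> \<open>The defining relations concern positive letters; the signs are adjusted one
    letter at a time.\<close>
  have half: "([(x, s), (y, False)], [(y, False), (x, s)]) \<in> raag_cong V E"
    if "adj E x y" "x \<in> V" "y \<in> V" for x y s
    using pos[OF that] raag_cong_commute_inv_letter[OF pos[OF that]] by (cases s) (auto simp: inv_letter_def)
  have "([(x, s), (y, t)], [(y, t), (x, s)]) \<in> raag_cong V E"
    if "adj E x y" "x \<in> V" "y \<in> V" for x y s t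
    using half[OF that] raag_cong_commute_inv_letter[OF word_cong.sym[OF half[OF that]]]
    by (cases t) (auto simp: inv_letter_def intro: word_cong.sym)
  from this[of "fst a" "fst b" "snd a" "snd b"] show ?thesis
    using assms by simp
qed

lemma raag_cong_move:
  assumes "\<forall>d\<in>set p. adj E (fst a) (fst d)" "fst a \<in> V" "p \<in> words V" "z \<in> words V"
  shows "(p @ a # z, a # p @ z) \<in> raag_cong V E"
  using assms
proof (induction p)
  case Nil
  then show ?case
    by (auto intro: word_cong.refl)
next
  case (Cons d p)
  have "([d] @ (p @ a # z) @ [], [d] @ (a # p @ z) @ []) \<in> raag_cong V E"
    using Cons by (intro word_cong_context) auto
  moreover have "([] @ [d, a] @ (p @ z), [] @ [a, d] @ (p @ z)) \<in> raag_cong V E"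
    using Cons.prems by (intro word_cong_context raag_cong_commute) (auto simp: adj_sym)
  ultimately show ?case
    by simp (meson word_cong.trans)
qed

text \<open>The head of \<open>u\<close> is initial in \<open>v\<close>, because projections decide
  this. Moved to the front of \<open>v\<close>, it can be stripped from both words, and the
  remainders again have equal projections.\<close>

lemma trace_eq_imp_raag_cong:
  assumes "trace_eq E u v" "u \<in> words V" "v \<in> words V"
  shows "(u, v) \<in> raag_cong V E"
  using assms
proof (induction u arbitrary: v)
  case Nil
  have "c \<notin> set v" for c
  proof -
    have "proj (fst c) (fst c) v = []"
      using Nil(1) unfolding trace_eq_def by (metis adj_irrefl proj_Nil)
    then show ?thesis
      by (auto simp: proj_def filter_empty_conv)
  qed
  then have "v = []"
    by (cases v) auto
  then show ?case
    by (simp add: word_cong.refl)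
next
  case (Cons a u)
  have "initial E a (a # u)"
    by (force simp: initial_def)
  then have "initial E a v"
    using initial_cong[OF Cons.prems(1)] by simp
  then obtain p z where v: "v = p @ a # z" and p: "\<forall>d\<in>set p. adj E (fst a) (fst d)"
    by (auto simp: initial_def)
  have "proj x y p = []" if "\<not> adj E x y" "fst a = x \<or> fst a = y" for x y
    using that proj_all_adj[OF p] by (metis adj_sym proj_commute)
  then have "trace_eq E u (p @ z)"
    using Cons.prems(1) by (fastforce simp: trace_eq_def v proj_Cons split: if_splits)
  then have "(u, p @ z) \<in> raag_cong V E"
    using Cons v by auto
  then have "([a] @ u @ [], [a] @ (p @ z) @ []) \<in> raag_cong V E"
    using Cons.prems by (intro word_cong_context) auto
  moreover have "(v, a # p @ z) \<in> raag_cong V E"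
    using Cons.prems p unfolding v by (intro raag_cong_move) auto
  ultimately show ?case
    by simp (meson word_cong.trans word_cong.sym)
qed

lemma push_raag_cong:
  assumes "fst a \<in> V" "w \<in> words V"
  shows "(a # w, push E a w) \<in> raag_cong V E"
proof (cases "initial E (inv_letter a) w")
  case True
  then obtain u z where w: "w = u @ inv_letter a # z" and u: "\<forall>d\<in>set u. adj E (fst a) (fst d)"
    by (auto simp: initial_def)
  have p: "push E a w = u @ z"
    using True u by (simp add: push_def w remove1_initial)
  have "([a] @ w @ [], [a] @ (inv_letter a # u @ z) @ []) \<in> raag_cong V E"
    using assms u unfolding w by (intro word_cong_context raag_cong_move) auto
  moreover have "([] @ [a, inv_letter a] @ (u @ z), [] @ [] @ (u @ z)) \<in> raag_cong V E"
    using assms w by (intro word_cong_context raag_cong_cancel) auto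
  ultimately show ?thesis
    unfolding p by simp (meson word_cong.trans)
next
  case False
  then show ?thesis
    using assms by (simp add: push_def word_cong.refl)
qed

lemma reduce_raag_cong: "w \<in> words V \<Longrightarrow> (w, reduce E w) \<in> raag_cong V E"
proof (induction w)
  case Nil
  then show ?case
    by (simp add: reduce_def word_cong.refl)
next
  case (Cons a w)
  then have "([a] @ w @ [], [a] @ reduce E w @ []) \<in> raag_cong V E"
    by (intro word_cong_context) auto
  moreover have "(a # reduce E w, push E a (reduce E w)) \<in> raag_cong V E"
    using Cons word_cong_words by (intro push_raag_cong) fastforce+
  ultimately show ?case
    by (simp add: reduce_def) (meson word_cong.trans)
qed

definition geodesic :: "'v set \<Rightarrow> 'v set set \<Rightarrow> 'v word \<Rightarrow> bool" where
  "geodesic V E w \<longleftrightarrow> w \<in> words V \<and> (\<forall>v. (w, v) \<in> raag_cong V E \<longrightarrow> length w \<le> length v)"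

text \<open>\<open>reduce\<close> keeps the element and never lengthens, so a geodesic keeps its
  length, which means that nothing was cancelled.\<close>

lemma geodesic_reduce:
  assumes "geodesic V E w"
  shows "reduce E w = w"
proof (rule reduce_eq_self)
  have "(w, reduce E w) \<in> raag_cong V E"
    using assms by (intro reduce_raag_cong) (simp add: geodesic_def)
  then show "length (reduce E w) = length w"
    using assms length_reduce_le[of E w] by (intro antisym) (simp_all add: geodesic_def)
qed

text \<open>Both words are their own reduced forms, so the invariance of \<open>reduce\<close>
  compares the words themselves.\<close>

lemma geodesic_trace_eq:
  assumes "geodesic V E u" "geodesic V E v" "(u, v) \<in> raag_cong V E"
  shows "trace_eq E u v"
  using reduce_cong[OF assms(3)] assms(1,2) by (simp add: geodesic_reduce)

section \<open>Balls in a right-angled Artin group\<close>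

abbreviation raag_elem :: "'v set \<Rightarrow> 'v set set \<Rightarrow> 'v word \<Rightarrow> 'v word set" where
  "raag_elem V E w \<equiv> raag_cong V E `` {w}"

lemma raag_elem_eq_iff:
  assumes "u \<in> words V" "v \<in> words V"
  shows "raag_elem V E u = raag_elem V E v \<longleftrightarrow> (u, v) \<in> raag_cong V E"
  using eq_equiv_class_iff[OF equiv_word_cong assms] .

lemma raag_elem_carrier: "w \<in> words V \<Longrightarrow> raag_elem V E w \<in> carrier (raag V E)"
  by (simp add: raag_def carrier_presented_group quotientI)

lemma raag_elemE:
  assumes "g \<in> carrier (raag V E)"
  obtains w where "w \<in> words V" "g = raag_elem V E w"
  using assms by (auto simp: raag_def carrier_presented_group elim!: quotientE)

lemma mult_raag_elem:
  "u \<in> words V \<Longrightarrow> v \<in> words V \<Longrightarrow>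
    raag_elem V E u \<otimes>\<^bsub>raag V E\<^esub> raag_elem V E v = raag_elem V E (u @ v)"
  by (simp add: raag_def mult_presented_group)

lemma one_raag_elem: "\<one>\<^bsub>raag V E\<^esub> = raag_elem V E []"
  by (simp add: raag_def one_presented_group)

lemma raag_generators_carrier: "raag_generators V E \<subseteq> carrier (raag V E)"
  by (auto simp: raag_generators_def raag_def presented_gen_carrier)

lemma raag_letters:
  "raag_generators V E \<union> m_inv (raag V E) ` raag_generators V E
    = (\<lambda>a. raag_elem V E [a]) ` (V \<times> UNIV)"
proof -
  have "(V \<times> (UNIV :: bool set)) = (\<lambda>x. (x, False)) ` V \<union> (\<lambda>x. (x, True)) ` V"
    by (auto simp: image_iff)
  moreover have "m_inv (raag V E) ` raag_generators V E = (\<lambda>x. raag_elem V E [(x, True)]) ` V"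
    unfolding raag_generators_def raag_def image_image by (simp add: inv_presented_gen cong: image_cong)
  ultimately show ?thesis
    by (simp add: raag_generators_def image_Un image_image presented_gen_def)
qed

lemma foldr_raag_elem:
  "w \<in> words V \<Longrightarrow>
    foldr (\<otimes>\<^bsub>raag V E\<^esub>) (map (\<lambda>a. raag_elem V E [a]) w) \<one>\<^bsub>raag V E\<^esub> = raag_elem V E w"
  by (induction w) (simp_all add: one_raag_elem mult_raag_elem)

text \<open>Generators and their inverses are the classes of one-letter words, so a product of them
  is the class of a word of the same length. Counting in balls becomes counting words up to
  \<open>raag_cong\<close>.\<close>

lemma word_ball_raag:
  "word_ball (raag V E) (raag_generators V E) n
    = raag_elem V E ` {w \<in> words V. length w \<le> n}" (is "?B = ?R")
proof -
  have B: "?B = {foldr (\<otimes>\<^bsub>raag V E\<^esub>) ws \<one>\<^bsub>raag V E\<^esub> | ws.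
      set ws \<subseteq> (\<lambda>a. raag_elem V E [a]) ` (V \<times> UNIV) \<and> length ws \<le> n}"
    unfolding word_ball_eq[OF group_raag raag_generators_carrier] raag_letters ..
  show ?thesis
  proof
    show "?B \<subseteq> ?R"
    proof
      fix g assume "g \<in> ?B"
      then obtain ws where g: "g = foldr (\<otimes>\<^bsub>raag V E\<^esub>) ws \<one>\<^bsub>raag V E\<^esub>" and len: "length ws \<le> n"
        and "ws \<in> lists ((\<lambda>a. raag_elem V E [a]) ` (V \<times> UNIV))"
        unfolding B by (auto simp: in_lists_conv_set)
      then obtain w where "w \<in> words V" "ws = map (\<lambda>a. raag_elem V E [a]) w"
        by (auto simp: lists_image words_def)
      with g len show "g \<in> ?R"
        using foldr_raag_elem by fastforce
    qed
    show "?R \<subseteq> ?B"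
    proof
      fix g assume "g \<in> ?R"
      then obtain w where w: "w \<in> words V" "length w \<le> n" "g = raag_elem V E w"
        by auto
      moreover have "set (map (\<lambda>a. raag_elem V E [a]) w) \<subseteq> (\<lambda>a. raag_elem V E [a]) ` (V \<times> UNIV)"
        using w by (force simp: words_def)
      ultimately show "g \<in> ?B"
        unfolding B using foldr_raag_elem[OF w(1)]
        by (intro CollectI exI[of _ "map (\<lambda>a. raag_elem V E [a]) w"]) simp
    qed
  qed
qed

lemma finite_word_ball_raag:
  assumes "finite V"
  shows "finite (word_ball (raag V E) (raag_generators V E) n)"
proof -
  have "{w \<in> words V. length w \<le> n} = {w. set w \<subseteq> V \<times> UNIV \<and> length w \<le> n}"
    by (auto simp: words_def in_lists_conv_set)
  then show ?thesis
    unfolding word_ball_raag using assms by (simp add: finite_lists_length_le)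
qed

section \<open>Exponential growth of balls\<close>

lemma reduce_positive:
  assumes "\<forall>a\<in>set w. \<not> snd a"
  shows "reduce E w = w"
  using assms
proof (induction w)
  case (Cons a w)
  have "\<not> initial E (inv_letter a) w"
    using Cons.prems by (force simp: initial_def inv_letter_def)
  with Cons show ?case
    by (simp add: reduce_def push_def)
qed (simp add: reduce_def)

text \<open>Positive words in \<open>x\<close> and \<open>y\<close> are unchanged by
  \<open>reduce\<close> and by the projection to these two vertices, so the \<open>2 ^ n\<close> of
  them of length \<open>n\<close> represent distinct elements.\<close>

lemma card_word_ball_raag_ge:
  assumes "finite V" "x \<in> V" "y \<in> V" "x \<noteq> y" "\<not> adj E x y"
  shows "2 ^ n \<le> card (word_ball (raag V E) (raag_generators V E) n)"
proof -
  define p where "p = map (\<lambda>b. (if b then x else y, False))"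
  define L where "L = {bs :: bool list. set bs \<subseteq> UNIV \<and> length bs = n}"
  have proj_p: "proj x y (p bs) = p bs" for bs
    by (auto simp: proj_def p_def filter_id_conv)
  have p_words: "p bs \<in> words V" for bs
    using assms by (induction bs) (auto simp: p_def)
  have "inj_on (raag_elem V E \<circ> p) L"
  proof (rule inj_onI)
    fix bs cs assume "(raag_elem V E \<circ> p) bs = (raag_elem V E \<circ> p) cs"
    then have "(p bs, p cs) \<in> raag_cong V E"
      using p_words by (simp add: raag_elem_eq_iff)
    then have "trace_eq E (reduce E (p bs)) (reduce E (p cs))"
      by (rule reduce_cong)
    moreover have "reduce E (p ds) = p ds" for ds
      by (rule reduce_positive) (auto simp: p_def)
    ultimately have "p bs = p cs"
      using assms(5) proj_p unfolding trace_eq_def by metis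
    moreover have "inj p"
      unfolding p_def using assms(4) by (intro inj_mapI injI) (simp split: if_splits)
    ultimately show "bs = cs"
      by (simp add: inj_eq)
  qed
  moreover have "(raag_elem V E \<circ> p) ` L \<subseteq> word_ball (raag V E) (raag_generators V E) n"
    unfolding word_ball_raag image_comp[symmetric]
    by (intro image_mono) (use p_words in \<open>auto simp: L_def p_def\<close>)
  ultimately have "card L \<le> card (word_ball (raag V E) (raag_generators V E) n)"
    using finite_word_ball_raag[OF assms(1)] by (intro card_inj_on_le)
  then show ?thesis
    unfolding L_def by (subst (asm) card_lists_length_eq) auto
qed

section \<open>Conjugacy classes\<close>

lemma conjugacy_classes_disjoint:
  assumes "group G" "C \<in> conjugacy_classes G" "D \<in> conjugacy_classes G" "g \<in> C" "g \<in> D"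
  shows "C = D"
  using group_action.disjoint_union[OF group.action_by_conjugation[OF assms(1)]] assms(2-)
  unfolding conjugacy_classes_def by blast

lemma conjugacy_classes_iff:
  "C \<in> conjugacy_classes G \<longleftrightarrow>
    (\<exists>h\<in>carrier G. C = {g \<otimes>\<^bsub>G\<^esub> h \<otimes>\<^bsub>G\<^esub> inv\<^bsub>G\<^esub> g | g. g \<in> carrier G})"
  unfolding conjugacy_classes_def orbits_def orbit_def
  by (auto cong: conj_cong)

lemma conjugacy_class_conj:
  assumes "group G" "C \<in> conjugacy_classes G" "g \<in> C" "a \<in> carrier G"
  shows "a \<otimes>\<^bsub>G\<^esub> g \<otimes>\<^bsub>G\<^esub> inv\<^bsub>G\<^esub> a \<in> C"
proof -
  interpret group G by fact
  obtain h where h: "h \<in> carrier G" "C = {g \<otimes>\<^bsub>G\<^esub> h \<otimes>\<^bsub>G\<^esub> inv\<^bsub>G\<^esub> g | g. g \<in> carrier G}"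
    using assms(2) by (auto simp: conjugacy_classes_iff)
  then obtain b where b: "b \<in> carrier G" "g = b \<otimes>\<^bsub>G\<^esub> h \<otimes>\<^bsub>G\<^esub> inv\<^bsub>G\<^esub> b"
    using assms(3) by blast
  have "a \<otimes>\<^bsub>G\<^esub> g \<otimes>\<^bsub>G\<^esub> inv\<^bsub>G\<^esub> a = (a \<otimes>\<^bsub>G\<^esub> b) \<otimes>\<^bsub>G\<^esub> h \<otimes>\<^bsub>G\<^esub> inv\<^bsub>G\<^esub> (a \<otimes>\<^bsub>G\<^esub> b)"
    using assms(4) b h(1) by (simp add: m_assoc inv_mult_group)
  then show ?thesis
    using h b assms(4) by blast
qed

text \<open>\<open>v u\<close> is the conjugate of \<open>u v\<close> by the inverse of
  \<open>u\<close>, so cyclic shifts of a word stay in the class.\<close>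

lemma conjugacy_class_swap:
  assumes "C \<in> conjugacy_classes (raag V E)" "raag_elem V E (u @ v) \<in> C" "u \<in> words V" "v \<in> words V"
  shows "raag_elem V E (v @ u) \<in> C"
proof -
  interpret group "raag V E" by (rule group_raag)
  let ?u = "raag_elem V E u" and ?v = "raag_elem V E v"
  have uv: "?u \<in> carrier (raag V E)" "?v \<in> carrier (raag V E)"
    using assms by (simp_all add: raag_elem_carrier)
  have "inv\<^bsub>raag V E\<^esub> ?u \<otimes>\<^bsub>raag V E\<^esub> (?u \<otimes>\<^bsub>raag V E\<^esub> ?v)
      \<otimes>\<^bsub>raag V E\<^esub> inv\<^bsub>raag V E\<^esub> (inv\<^bsub>raag V E\<^esub> ?u) \<in> C"
    using assms uv by (intro conjugacy_class_conj[OF group_raag]) (auto simp: mult_raag_elem)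
  moreover have "inv\<^bsub>raag V E\<^esub> ?u \<otimes>\<^bsub>raag V E\<^esub> (?u \<otimes>\<^bsub>raag V E\<^esub> ?v)
      \<otimes>\<^bsub>raag V E\<^esub> inv\<^bsub>raag V E\<^esub> (inv\<^bsub>raag V E\<^esub> ?u) = ?v \<otimes>\<^bsub>raag V E\<^esub> ?u"
    using uv by (simp add: m_assoc[symmetric])
  ultimately show ?thesis
    using assms by (simp add: mult_raag_elem)
qed

section \<open>Cyclic shifts and their projections\<close>

lemma filter_eq_append:
  assumes "filter P w = a @ b"
  shows "\<exists>u v. w = u @ v \<and> filter P u = a \<and> filter P v = b"
  using assms
proof (induction w arbitrary: a)
  case (Cons c w)
  show ?case
  proof (cases "a = [] \<or> \<not> P c")
    case True
    then show ?thesis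
    proof
      assume "a = []"
      then show ?thesis
        using Cons.prems by (intro exI[of _ "[]"] exI[of _ "c # w"]) simp
    next
      assume "\<not> P c"
      moreover from this obtain u v where "w = u @ v \<and> filter P u = a \<and> filter P v = b"
        using Cons by auto
      ultimately show ?thesis
        by (intro exI[of _ "c # u"] exI[of _ v]) simp
    qed
  next
    case False
    then obtain a' where "a = c # a'" "filter P w = a' @ b"
      using Cons.prems by (auto simp: Cons_eq_append_conv)
    moreover from this(2) obtain u v where "w = u @ v \<and> filter P u = a' \<and> filter P v = b"
      using Cons.IH by blast
    ultimately show ?thesis
      using False by (intro exI[of _ "c # u"] exI[of _ v]) simp
  qed
qed simp

text \<open>A cut of the projection lifts to a cut of \<open>w\<close>, and exchanging the two
  pieces of \<open>w\<close> exchanges those of the projection.\<close>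

lemma proj_rotate:
  obtains u v where "w = u @ v" "proj x y (v @ u) = rotate j (proj x y w)"
proof -
  let ?p = "proj x y w"
  let ?m = "j mod length ?p"
  have "\<exists>u v. w = u @ v \<and> proj x y u = take ?m ?p \<and> proj x y v = drop ?m ?p"
    unfolding proj_def by (rule filter_eq_append) simp
  then obtain u v where uv: "w = u @ v" "proj x y u = take ?m ?p" "proj x y v = drop ?m ?p"
    by blast
  have "proj x y (v @ u) = rotate j ?p"
    unfolding proj_append rotate_drop_take uv(2,3) ..
  with uv(1) show ?thesis
    by (rule that)
qed

lemma inj_rotate: "inj (rotate n)"
  unfolding rotate_def by (rule inj_fn[OF inj_rotate1])

text \<open>The period refers to rotation and may be a multiple of the length, so a nonempty list of
  length below \<open>k\<close> always has one.\<close>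

definition periodic_lists :: "'a set \<Rightarrow> nat \<Rightarrow> nat \<Rightarrow> 'a list set" where
  "periodic_lists A k n = {p. set p \<subseteq> A \<and> length p \<le> n \<and> (\<exists>d. 0 < d \<and> d < k \<and> rotate d p = p)}"

lemma small_conjugacy_class:
  assumes "finite V" "C \<in> conjugacy_classes (raag V E)"
    and "C \<inter> word_ball (raag V E) (raag_generators V E) n \<noteq> {}"
    and "card (C \<inter> word_ball (raag V E) (raag_generators V E) n) < k"
  shows "\<exists>w\<in>words V. raag_elem V E w \<in> C
    \<and> (\<forall>x y. \<not> adj E x y \<longrightarrow> proj x y w \<in> periodic_lists (V \<times> UNIV) k n)"
proof -
  let ?B = "word_ball (raag V E) (raag_generators V E) n"
  obtain w0 where w0: "w0 \<in> words V" "raag_elem V E w0 \<in> C" "length w0 \<le> n"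
    using assms(3) by (auto simp: word_ball_raag)
  \<comment> \<open>Minimality over the whole class, not just over one element, makes every cyclic
    shift of \<open>w\<close> geodesic.\<close>
  obtain w where w: "w \<in> words V" "raag_elem V E w \<in> C"
    and least: "\<And>v. v \<in> words V \<Longrightarrow> raag_elem V E v \<in> C \<Longrightarrow> length w \<le> length v"
    using ex_has_least_nat[of "\<lambda>w. w \<in> words V \<and> raag_elem V E w \<in> C" w0 length] w0 by blast
  have len: "length w \<le> n"
    using least[OF w0(1,2)] w0(3) by simp
  have geo: "geodesic V E v" if "v \<in> words V" "raag_elem V E v \<in> C" "length v = length w" for v
    unfolding geodesic_def
  proof (intro conjI allI impI)
    fix v' assume "(v, v') \<in> raag_cong V E"
    moreover from this have "v' \<in> words V"
      using word_cong_words by blast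
    ultimately show "length v \<le> length v'"
      using that least[of v'] raag_elem_eq_iff[of v V v' E] by auto
  qed fact
  have "proj x y w \<in> periodic_lists (V \<times> UNIV) k n" if "\<not> adj E x y" for x y
  proof -
    let ?p = "proj x y w"
    have "\<exists>z. z \<in> words V \<and> length z = length w \<and> raag_elem V E z \<in> C \<and> proj x y z = rotate j ?p" for j
    proof -
      obtain u v where uv: "w = u @ v" "proj x y (v @ u) = rotate j ?p"
        by (rule proj_rotate)
      then show ?thesis
        using w conjugacy_class_swap[OF assms(2), of u v] by (intro exI[of _ "v @ u"]) auto
    qed
    then obtain z where z: "\<And>j. z j \<in> words V" "\<And>j. length (z j) = length w"
      "\<And>j. raag_elem V E (z j) \<in> C" "\<And>j. proj x y (z j) = rotate j ?p"
      by metis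
    \<comment> \<open>The shifts have length at most \<open>n\<close>, so their elements lie in the
      ball; fewer than \<open>k\<close> elements are available for \<open>k\<close> indices.\<close>
    have "(\<lambda>j. raag_elem V E (z j)) ` {..<k} \<subseteq> C \<inter> ?B"
      using z len by (auto simp: word_ball_raag)
    then have "card ((\<lambda>j. raag_elem V E (z j)) ` {..<k}) \<le> card (C \<inter> ?B)"
      using finite_word_ball_raag[OF assms(1)] by (intro card_mono) auto
    then have "card ((\<lambda>j. raag_elem V E (z j)) ` {..<k}) < card {..<k}"
      using assms(4) by simp
    then have "\<not> inj_on (\<lambda>j. raag_elem V E (z j)) {..<k}"
      by (rule pigeonhole)
    then obtain i j where ij: "i < j" "j < k" "raag_elem V E (z i) = raag_elem V E (z j)"
      unfolding inj_on_def by (metis lessThan_iff linorder_neqE_nat)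
    have "(z i, z j) \<in> raag_cong V E"
      using ij(3) z(1) by (simp add: raag_elem_eq_iff)
    then have "trace_eq E (z i) (z j)"
      by (intro geodesic_trace_eq[where V = V] geo z)
    then have "rotate i ?p = rotate j ?p"
      using that unfolding trace_eq_def by (simp flip: z(4))
    \<comment> \<open>Writing \<open>j\<close> as \<open>i + (j - i)\<close> and cancelling the
      injective \<open>rotate i\<close> leaves the period \<open>j - i\<close>.\<close>
    then have "rotate i (rotate (j - i) ?p) = rotate i ?p"
      using ij(1) by (simp add: rotate_rotate)
    then have "rotate (j - i) ?p = ?p"
      by (rule injD[OF inj_rotate])
    moreover have "0 < j - i" "j - i < k"
      using ij by simp_all
    moreover have "set ?p \<subseteq> V \<times> UNIV"
      using w(1) by (auto simp: proj_def words_def)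
    moreover have "length ?p \<le> n"
      unfolding proj_def using length_filter_le len by (rule le_trans)
    ultimately show ?thesis
      unfolding periodic_lists_def by blast
  qed
  with w show ?thesis
    by blast
qed

section \<open>Counting\<close>

lemma nth_rotate_periodic:
  assumes "rotate d p = p" "d \<le> i" "i < length p"
  shows "p ! i = p ! (i - d)"
proof -
  have "rotate d p ! (i - d) = p ! ((d + (i - d)) mod length p)"
    using assms by (intro nth_rotate) simp
  with assms show ?thesis
    by simp
qed

text \<open>An entry at an index of at least \<open>k\<close> equals the one \<open>d\<close> places
  earlier, so every entry is traced back into the common prefix.\<close>

lemma periodic_lists_eqI:
  assumes "rotate d p = p" "rotate d q = q" "0 < d" "d < k" "length p = length q" "take k p = take k q"
  shows "p = q"
proof (rule nth_equalityI)
  fix i assume "i < length p"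
  then show "p ! i = q ! i"
  proof (induction i rule: less_induct)
    case (less i)
    show ?case
    proof (cases "i < k")
      case True
      then show ?thesis
        using assms(6) by (metis nth_take)
    next
      case False
      then have "p ! i = p ! (i - d)" "q ! i = q ! (i - d)"
        using assms less.prems by (auto intro!: nth_rotate_periodic)
      moreover have "p ! (i - d) = q ! (i - d)"
        using False assms(3,4) less.prems by (intro less.IH) auto
      ultimately show ?thesis
        by simp
    qed
  qed
qed fact

text \<open>A list is recovered from its length, a period and its first \<open>k\<close> entries. Of
  the ranges of these three data only that of the length grows with \<open>n\<close>, so the bound
  is linear in \<open>n\<close>.\<close>

lemma card_periodic_lists:
  assumes "finite A"
  shows "finite (periodic_lists A k n)"
    and "card (periodic_lists A k n) \<le> (n + 1) * (k * card {xs. set xs \<subseteq> A \<and> length xs \<le> k})"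
proof -
  let ?L = "{xs. set xs \<subseteq> A \<and> length xs \<le> k}"
  have "\<exists>d. \<forall>p\<in>periodic_lists A k n. 0 < d p \<and> d p < k \<and> rotate (d p) p = p"
    by (intro bchoice) (simp add: periodic_lists_def)
  then obtain d where d: "\<And>p. p \<in> periodic_lists A k n \<Longrightarrow> 0 < d p \<and> d p < k \<and> rotate (d p) p = p"
    by blast
  let ?f = "\<lambda>p. (length p, d p, take k p)"
  have "inj_on ?f (periodic_lists A k n)"
  proof (rule inj_onI)
    fix p q
    assume "p \<in> periodic_lists A k n" "q \<in> periodic_lists A k n" "?f p = ?f q"
    with d[of p] d[of q] show "p = q"
      using periodic_lists_eqI[of "d p" p q k] by simp
  qed
  moreover have "?f ` periodic_lists A k n \<subseteq> {..n} \<times> {..<k} \<times> ?L"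
    using d by (fastforce simp: periodic_lists_def dest: in_set_takeD)
  moreover have fin: "finite ({..n} \<times> {..<k} \<times> ?L)"
    using finite_lists_length_le[OF assms] by simp
  ultimately have "card (periodic_lists A k n) \<le> card ({..n} \<times> {..<k} \<times> ?L)"
    by (rule card_inj_on_le)
  then show "card (periodic_lists A k n) \<le> (n + 1) * (k * card ?L)"
    by (simp add: card_cartesian_product)
  show "finite (periodic_lists A k n)"
    by (rule finite_subset[OF _ finite_lists_length_le[OF assms, of n]]) (auto simp: periodic_lists_def)
qed

text \<open>A vertex outside \<open>V\<close> carries no letters, so a projection involving one is
  empty or a single-vertex projection.\<close>

lemma trace_eqI_words:
  assumes "u \<in> words V" "v \<in> words V"
    and "\<And>x y. x \<in> V \<Longrightarrow> y \<in> V \<Longrightarrow> \<not> adj E x y \<Longrightarrow> proj x y u = proj x y v"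
  shows "trace_eq E u v"
proof -
  have outside: "proj x y w = proj x x w" if "w \<in> words V" "y \<notin> V" for x y w
    using that by (auto simp: proj_def words_def intro!: filter_cong)
  have empty: "proj x x w = []" if "w \<in> words V" "x \<notin> V" for x w
    using that by (auto simp: proj_def words_def filter_empty_conv)
  have "proj x y u = proj x y v" if "\<not> adj E x y" for x y
    using assms that outside empty proj_commute adj_irrefl by (smt (verit))
  then show ?thesis
    by (simp add: trace_eq_def)
qed

text \<open>The projections at the pairs in \<open>N\<close> determine the element represented by a
  word chosen in each class, and distinct classes are disjoint. Each of the \<open>card N\<close>
  coordinates takes at most \<open>K * (n + 1)\<close> values.\<close>

lemma card_small_conjugacy_classes:
  fixes V :: "'v set" and E :: "'v set set"
  assumes "finite V"
  defines "B \<equiv> \<lambda>n. word_ball (raag V E) (raag_generators V E) n"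
  shows "\<exists>K M. \<forall>n. card {C \<in> conjugacy_classes (raag V E). C \<inter> B n \<noteq> {} \<and> card (C \<inter> B n) < k}
    \<le> (K * (n + 1)) ^ M"
proof -
  let ?A = "V \<times> (UNIV :: bool set)"
  define K where "K = k * card {xs. set xs \<subseteq> ?A \<and> length xs \<le> k}"
  define N where "N = {(x, y) \<in> V \<times> V. \<not> adj E x y}"
  have finN: "finite N"
    unfolding N_def by (rule finite_subset[of _ "V \<times> V"]) (use assms in auto)
  have finA: "finite ?A"
    using assms by simp
  have "card {C \<in> conjugacy_classes (raag V E). C \<inter> B n \<noteq> {} \<and> card (C \<inter> B n) < k}
    \<le> (K * (n + 1)) ^ card N" (is "card ?S \<le> _") for n
  proof -
    let ?P = "periodic_lists ?A k n"
    have "\<exists>w. \<forall>C\<in>?S. w C \<in> words V \<and> raag_elem V E (w C) \<in> C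
        \<and> (\<forall>x y. \<not> adj E x y \<longrightarrow> proj x y (w C) \<in> ?P)"
    proof (rule bchoice, rule ballI)
      fix C assume "C \<in> ?S"
      then show "\<exists>w. w \<in> words V \<and> raag_elem V E w \<in> C \<and> (\<forall>x y. \<not> adj E x y \<longrightarrow> proj x y w \<in> ?P)"
        using small_conjugacy_class[OF assms(1), of C E n k] by (auto simp: B_def)
    qed
    then obtain w where "\<forall>C\<in>?S. w C \<in> words V \<and> raag_elem V E (w C) \<in> C
        \<and> (\<forall>x y. \<not> adj E x y \<longrightarrow> proj x y (w C) \<in> ?P)" ..
    from bspec[OF this] have w: "w C \<in> words V" "raag_elem V E (w C) \<in> C" "\<And>x y. \<not> adj E x y \<Longrightarrow> proj x y (w C) \<in> ?P"
      if "C \<in> ?S" for C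
      using that by simp_all
    \<comment> \<open>Restricting the family of projections to \<open>N\<close> makes it an element
      of a finite product.\<close>
    let ?f = "\<lambda>C. \<lambda>(x, y)\<in>N. proj x y (w C)"
    have "inj_on ?f ?S"
    proof (rule inj_onI)
      fix C D assume CD: "C \<in> ?S" "D \<in> ?S" "?f C = ?f D"
      have "proj x y (w C) = proj x y (w D)" if "x \<in> V" "y \<in> V" "\<not> adj E x y" for x y
        using fun_cong[OF CD(3), of "(x, y)"] that by (simp add: N_def)
      then have "trace_eq E (w C) (w D)"
        using w(1) CD by (intro trace_eqI_words[where V = V]) auto
      then have "raag_elem V E (w C) = raag_elem V E (w D)"
        using w(1) CD by (simp add: raag_elem_eq_iff trace_eq_imp_raag_cong)
      then have "raag_elem V E (w C) \<in> C" "raag_elem V E (w C) \<in> D"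
        using w(2)[OF CD(1)] w(2)[OF CD(2)] by simp_all
      then show "C = D"
        using CD by (intro conjugacy_classes_disjoint[OF group_raag, of C V E D]) simp_all
    qed
    moreover have "?f ` ?S \<subseteq> (\<Pi>\<^sub>E i\<in>N. ?P)"
    proof (rule image_subsetI)
      fix C assume "C \<in> ?S"
      from w(3)[OF this] show "?f C \<in> (\<Pi>\<^sub>E i\<in>N. ?P)"
        unfolding restrict_PiE_iff by (auto simp: N_def)
    qed
    moreover have "finite (\<Pi>\<^sub>E i\<in>N. ?P)"
      using finN card_periodic_lists(1)[OF finA] by (intro finite_PiE)
    ultimately have "card ?S \<le> card (\<Pi>\<^sub>E i\<in>N. ?P)"
      by (rule card_inj_on_le)
    also have "\<dots> = card ?P ^ card N"
      using finN by (simp add: card_PiE)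
    also have "\<dots> \<le> (K * (n + 1)) ^ card N"
      using card_periodic_lists(2)[OF finA, of k n] by (intro power_mono) (simp_all add: K_def mult.commute)
    finally show ?thesis .
  qed
  then show ?thesis
    by blast
qed

section \<open>Vanishing of the ratio\<close>

lemma card_disjoint_family_le:
  assumes "finite B" "finite F" "\<And>C D. C \<in> F \<Longrightarrow> D \<in> F \<Longrightarrow> C \<noteq> D \<Longrightarrow> C \<inter> D = {}"
    and "\<And>C. C \<in> F \<Longrightarrow> k \<le> card (C \<inter> B)"
  shows "k * card F \<le> card B"
proof -
  have "k * card F = (\<Sum>C\<in>F. k)"
    by simp
  also have "\<dots> \<le> (\<Sum>C\<in>F. card (C \<inter> B))"
    using assms(4) by (rule sum_mono)
  also have "\<dots> = card (\<Union>C\<in>F. C \<inter> B)"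
    using assms by (subst card_UN_disjoint) blast+
  also have "\<dots> \<le> card B"
    using assms(1) by (intro card_mono) auto
  finally show ?thesis .
qed

text \<open>Classes are disjoint, so choosing a representative in the ball is injective.\<close>

lemma finite_ball_conjugacy_classes:
  assumes "group G" "finite (word_ball G X n)"
  shows "finite (ball_conjugacy_classes G X n)"
proof -
  have "\<exists>f. \<forall>C\<in>ball_conjugacy_classes G X n. f C \<in> C \<inter> word_ball G X n"
    by (intro bchoice) (auto simp: ball_conjugacy_classes_def)
  then obtain f where f: "\<And>C. C \<in> ball_conjugacy_classes G X n \<Longrightarrow> f C \<in> C \<inter> word_ball G X n"
    by blast
  have "inj_on f (ball_conjugacy_classes G X n)"
  proof (rule inj_onI)
    fix C D assume "C \<in> ball_conjugacy_classes G X n" "D \<in> ball_conjugacy_classes G X n" "f C = f D"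
    then show "C = D"
      using f[of C] f[of D] conjugacy_classes_disjoint[OF assms(1), of C D "f C"]
      by (auto simp: ball_conjugacy_classes_def)
  qed
  moreover have "f ` ball_conjugacy_classes G X n \<subseteq> word_ball G X n"
    using f by blast
  ultimately show ?thesis
    using assms(2) inj_on_finite by blast
qed

lemma conjugacy_ratio_nonadjacent:
  fixes V :: "'v set" and E :: "'v set set"
  assumes "finite V" "x \<in> V" "y \<in> V" "x \<noteq> y" "\<not> adj E x y"
  shows "conjugacy_ratio (raag V E) (raag_generators V E) = 0"
proof -
  let ?G = "raag V E"
  define B where "B n = word_ball ?G (raag_generators V E) n" for n
  define C where "C n = ball_conjugacy_classes ?G (raag_generators V E) n" for n
  have finB: "finite (B n)" for n
    unfolding B_def using finite_word_ball_raag[OF assms(1)] .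
  have finC: "finite (C n)" for n
    using finite_ball_conjugacy_classes[OF group_raag] finB unfolding B_def C_def .
  have B_ge: "2 ^ n \<le> card (B n)" for n
    unfolding B_def by (rule card_word_ball_raag_ge[OF assms])
  have "(\<lambda>n. real (card (C n)) / real (card (B n))) \<longlonglongrightarrow> 0"
  proof (rule LIMSEQ_I, goal_cases)
    case (1 e)
    \<comment> \<open>Classes with at least \<open>k\<close> elements in the ball contribute at most
      \<open>1 / k\<close> to the ratio. The others are left to large \<open>n\<close>, with a
      polynomial bound that depends on \<open>k\<close>.\<close>
    obtain k :: nat where k: "0 < k" "1 / real k < e / 2"
      using 1 reals_Archimedean[of "e / 2"] by (metis half_gt_zero inverse_eq_divide zero_less_Suc)
    obtain K M where KM: "\<And>n. card {D \<in> conjugacy_classes ?G. D \<inter> B n \<noteq> {} \<and> card (D \<inter> B n) < k}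
        \<le> (K * (n + 1)) ^ M"
      using card_small_conjugacy_classes[OF assms(1)] unfolding B_def by blast
    have bound: "real (card (C n)) / real (card (B n)) \<le> 1 / real k + real ((K * (n + 1)) ^ M) / 2 ^ n" for n
    proof -
      let ?F = "{D \<in> C n. k \<le> card (D \<inter> B n)}"
      let ?S = "{D \<in> conjugacy_classes ?G. D \<inter> B n \<noteq> {} \<and> card (D \<inter> B n) < k}"
      have pos: "0 < card (B n)"
        by (rule less_le_trans[OF _ B_ge]) simp
      have "k * card ?F \<le> card (B n)"
      proof (rule card_disjoint_family_le)
        fix D D' assume "D \<in> ?F" "D' \<in> ?F" "D \<noteq> D'"
        then show "D \<inter> D' = {}"
          using conjugacy_classes_disjoint[OF group_raag, of D V E D']
          by (auto simp: C_def ball_conjugacy_classes_def)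
      qed (use finB finC in auto)
      then have F: "real (card ?F) \<le> real (card (B n)) / real k"
        using k by (simp add: field_simps flip: of_nat_mult)
      have "C n = ?F \<union> ?S"
        by (auto simp: C_def B_def ball_conjugacy_classes_def)
      then have "card (C n) \<le> card ?F + card ?S"
        using card_Un_le[of ?F ?S] by simp
      then have "real (card (C n)) \<le> real (card (B n)) / real k + real ((K * (n + 1)) ^ M)"
        using F KM[of n] by linarith
      then have "real (card (C n)) / real (card (B n))
          \<le> (real (card (B n)) / real k + real ((K * (n + 1)) ^ M)) / real (card (B n))"
        by (rule divide_right_mono) simp
      also have "\<dots> = 1 / real k + real ((K * (n + 1)) ^ M) / real (card (B n))"
        using pos by (simp add: add_divide_distrib)
      also have "\<dots> \<le> 1 / real k + real ((K * (n + 1)) ^ M) / 2 ^ n"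
      proof -
        have "(2::real) ^ n \<le> real (card (B n))"
          using B_ge[of n] by (metis of_nat_le_iff of_nat_numeral of_nat_power)
        then show ?thesis
          using pos by (intro add_left_mono divide_left_mono) auto
      qed
      finally show ?thesis .
    qed
    have "(\<lambda>n. real ((K * (n + 1)) ^ M) / 2 ^ n) \<longlonglongrightarrow> 0"
    proof -
      have "(\<lambda>n. (real n + 1) ^ M / 2 ^ n) \<longlonglongrightarrow> 0"
        by real_asymp
      from tendsto_mult_left[OF this, of "real K ^ M"] show ?thesis
        by (simp only: of_nat_power of_nat_mult of_nat_add of_nat_1 power_mult_distrib
            times_divide_eq_right mult_zero_right)
    qed
    then have "\<forall>\<^sub>F n in sequentially. real ((K * (n + 1)) ^ M) / 2 ^ n < e / 2"
      using 1 by (intro order_tendstoD) auto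
    then obtain n0 where "\<And>n. n0 \<le> n \<Longrightarrow> real ((K * (n + 1)) ^ M) / 2 ^ n < e / 2"
      by (auto simp: eventually_sequentially)
    then have "norm (real (card (C n)) / real (card (B n)) - 0) < e" if "n0 \<le> n" for n
      using bound[of n] k(2) that by (smt (verit) divide_nonneg_nonneg field_sum_of_halves of_nat_0_le_iff real_norm_def)
    then show ?case
      by blast
  qed
  then have "(\<lambda>n. ereal (real (card (C n)) / real (card (B n)))) \<longlonglongrightarrow> 0"
    unfolding zero_ereal_def by (rule tendsto_ereal)
  then show ?thesis
    unfolding conjugacy_ratio_def B_def C_def by (intro lim_imp_Limsup) simp
qed

section \<open>The abelian case\<close>

lemma free_abelian_imp_comm_group:
  assumes "group G" "free_abelian G"
  shows "comm_group G"
proof -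
  obtain S :: "'a set" where "G \<cong> free_Abelian_group S"
    using assms(2) unfolding free_abelian_def ..
  then have "free_Abelian_group S \<cong> G"
    by (rule group.iso_sym[OF assms(1)])
  then show ?thesis
    by (rule comm_group.iso_imp_comm_group[OF abelian_free_Abelian_group _ group.is_monoid[OF assms(1)]])
qed

lemma conjugacy_ratio_comm_group:
  assumes "comm_group G" "\<And>n. finite (word_ball G X n)"
  shows "conjugacy_ratio G X = 1"
proof -
  interpret comm_group G by fact
  have conj: "g \<otimes>\<^bsub>G\<^esub> h \<otimes>\<^bsub>G\<^esub> inv\<^bsub>G\<^esub> g = h" if "g \<in> carrier G" "h \<in> carrier G" for g h
    using that by (metis inv_closed inv_solve_right m_closed m_comm)
  have singleton: "{g \<otimes>\<^bsub>G\<^esub> h \<otimes>\<^bsub>G\<^esub> inv\<^bsub>G\<^esub> g | g. g \<in> carrier G} = {h}" if "h \<in> carrier G" for h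
    using that conj by (auto intro!: exI[of _ "\<one>\<^bsub>G\<^esub>"])
  have classes: "conjugacy_classes G = (\<lambda>g. {g}) ` carrier G"
    by (auto simp: conjugacy_classes_iff singleton)
  have ball: "ball_conjugacy_classes G X n = (\<lambda>g. {g}) ` word_ball G X n" for n
    unfolding ball_conjugacy_classes_def classes by (auto simp: word_ball_def)
  \<comment> \<open>The empty product puts the identity into every ball, which excludes the quotient
    \<open>0 / 0\<close>, whose value would be \<open>0\<close>.\<close>
  have "word_length G X \<one>\<^bsub>G\<^esub> \<le> enat n" for n
    unfolding word_length_def by (rule INF_lower2[of "[]"]) auto
  then have "\<one>\<^bsub>G\<^esub> \<in> word_ball G X n" for n
    by (simp add: word_ball_def)
  then have "card (word_ball G X n) \<noteq> 0" for n
    using assms(2) by auto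
  moreover have "card (ball_conjugacy_classes G X n) = card (word_ball G X n)" for n
    unfolding ball by (rule card_image) simp
  ultimately have "real (card (ball_conjugacy_classes G X n)) / real (card (word_ball G X n)) = 1" for n
    by (metis div_self of_nat_eq_0_iff)
  then show ?thesis
    unfolding conjugacy_ratio_def by (simp only: Limsup_const sequentially_bot not_False_eq_True one_ereal_def)
qed

text \<open>Commutation passes from two letters to a letter and a word, and then to two
  words.\<close>

lemma raag_complete_comm_group:
  assumes "\<And>x y. x \<in> V \<Longrightarrow> y \<in> V \<Longrightarrow> x \<noteq> y \<Longrightarrow> adj E x y"
  shows "comm_group (raag V E)"
proof (rule group.group_comm_groupI[OF group_raag])
  have letters: "([a, b], [b, a]) \<in> raag_cong V E" if V: "fst a \<in> V" "fst b \<in> V" for a b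
  proof (cases "fst a = fst b")
    case True
    \<comment> \<open>Two letters on one vertex are equal or mutually inverse; in the latter case
      both products are trivial.\<close>
    then have "b = a \<or> b = inv_letter a"
      by (cases a; cases b) (auto simp: inv_letter_def)
    then show ?thesis
    proof
      assume "b = a"
      then show ?thesis
        using V by (simp add: word_cong.refl)
    next
      assume "b = inv_letter a"
      then show ?thesis
        using word_cong.trans[OF raag_cong_cancel[OF V(1)] word_cong.sym[OF raag_cong_cancel[OF V(2)]]]
        by simp
    qed
  next
    case False
    then show ?thesis
      using V assms by (intro raag_cong_commute) auto
  qed
  have letter_word: "(a # v, v @ [a]) \<in> raag_cong V E" if "fst a \<in> V" "v \<in> words V" for a v
    using that(2)
  proof (induction v)
    case Nil
    then show ?case
      using that by (auto intro: word_cong.refl)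
  next
    case (Cons b v)
    have "([] @ [a, b] @ v, [] @ [b, a] @ v) \<in> raag_cong V E"
      using Cons.prems that by (intro word_cong_context letters) auto
    moreover have "([b] @ (a # v) @ [], [b] @ (v @ [a]) @ []) \<in> raag_cong V E"
      using Cons by (intro word_cong_context) auto
    ultimately show ?case
      by simp (meson word_cong.trans)
  qed
  have comm: "(u @ v, v @ u) \<in> raag_cong V E" if "u \<in> words V" "v \<in> words V" for u v
    using that
  proof (induction u arbitrary: v)
    case Nil
    then show ?case
      by (simp add: word_cong.refl)
  next
    case (Cons a u)
    then have "([a] @ (u @ v) @ [], [a] @ (v @ u) @ []) \<in> raag_cong V E"
      by (intro word_cong_context) auto
    moreover have "([] @ (a # v) @ u, [] @ (v @ [a]) @ u) \<in> raag_cong V E"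
      using Cons.prems by (intro word_cong_context letter_word) auto
    ultimately show ?case
      by simp (meson word_cong.trans)
  qed
  fix g h assume "g \<in> carrier (raag V E)" "h \<in> carrier (raag V E)"
  then obtain u v where "u \<in> words V" "g = raag_elem V E u" "v \<in> words V" "h = raag_elem V E v"
    by (elim raag_elemE)
  then show "g \<otimes>\<^bsub>raag V E\<^esub> h = h \<otimes>\<^bsub>raag V E\<^esub> g"
    by (simp add: mult_raag_elem raag_elem_eq_iff comm)
qed

text \<open>The standard generators form a basis. The map \<psi> comes from the universal property;
  its inverse is induced by the exponent vector \<theta> of a word.\<close>

lemma raag_complete_free_abelian:
  assumes "\<And>x y. x \<in> V \<Longrightarrow> y \<in> V \<Longrightarrow> x \<noteq> y \<Longrightarrow> adj E x y"
  shows "free_abelian (raag V E)"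
proof -
  interpret comm_group "raag V E"
    by (rule raag_complete_comm_group) fact
  let ?S = "raag_generators V E"
  let ?gen = "presented_gen V (raag_relations E)"
  let ?F = "free_Abelian_group ?S"
  have gen: "?gen x = raag_elem V E [(x, False)]" for x
    by (simp add: presented_gen_def)
  obtain \<psi> where \<psi>: "\<psi> \<in> hom ?F (raag V E)" and \<psi>_gen: "\<And>g. g \<in> ?S \<Longrightarrow> \<psi> (frag_of g) = g"
    using free_Abelian_group_universal[of "\<lambda>g. g" ?S] raag_generators_carrier[of V E] by auto
  interpret \<psi>: group_hom ?F "raag V E" \<psi>
    by (simp add: group_hom_def group_hom_axioms_def \<psi> group_raag)
  define sgn where "sgn a = (if snd a then - frag_of (?gen (fst a)) else frag_of (?gen (fst a)))" for a
  define \<theta> where "\<theta> w = (\<Sum>a\<leftarrow>w. sgn a)" for w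
  \<comment> \<open>Opposite letters have opposite values under \<open>sgn\<close>, and addition
    commutes.\<close>
  have \<theta>_cong: "\<theta> u = \<theta> v" if "(u, v) \<in> raag_cong V E" for u v
    using that by (induction rule: word_cong.induct) (auto simp: \<theta>_def sgn_def raag_relations_def)
  have sgn_carrier: "sgn a \<in> carrier ?F" if "fst a \<in> V" for a
    using that by (simp add: sgn_def raag_generators_def)
  have \<theta>_carrier: "\<theta> w \<in> carrier ?F" if "w \<in> words V" for w
    using that
  proof (induction w)
    case (Cons a w)
    then show ?case
      using sgn_carrier[of a] keys_add[of "sgn a" "\<theta> w"] by (auto simp: \<theta>_def)
  qed (simp add: \<theta>_def)
  have \<psi>_sgn: "\<psi> (sgn a) = raag_elem V E [a]" if "fst a \<in> V" for a
  proof -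
    have S: "?gen (fst a) \<in> ?S"
      using that by (simp add: raag_generators_def)
    show ?thesis
    proof (cases "snd a")
      case True
      have "\<psi> (inv\<^bsub>?F\<^esub> (frag_of (?gen (fst a)))) = inv\<^bsub>raag V E\<^esub> \<psi> (frag_of (?gen (fst a)))"
        using S by (intro \<psi>.hom_inv) simp
      then show ?thesis
        using S True that inv_presented_gen[of "fst a" V "raag_relations E"]
        by (simp add: sgn_def \<psi>_gen raag_def) (metis prod.collapse)
    next
      case False
      then show ?thesis
        using S by (simp add: sgn_def \<psi>_gen gen) (metis prod.collapse)
    qed
  qed
  have \<psi>\<theta>: "\<psi> (\<theta> w) = raag_elem V E w" if "w \<in> words V" for w
    using that
  proof (induction w)
    case Nil
    then show ?case
      using \<psi>.hom_one by (simp add: \<theta>_def one_raag_elem)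
  next
    case (Cons a w)
    have "\<psi> (sgn a \<otimes>\<^bsub>?F\<^esub> \<theta> w) = \<psi> (sgn a) \<otimes>\<^bsub>raag V E\<^esub> \<psi> (\<theta> w)"
      using Cons.prems sgn_carrier \<theta>_carrier by (intro \<psi>.hom_mult) auto
    then show ?case
      using Cons by (simp add: \<theta>_def \<psi>_sgn mult_raag_elem)
  qed
  have \<theta>_surj: "\<exists>w\<in>words V. \<theta> w = c" if "c \<in> carrier ?F" for c
  proof (rule free_Abelian_group_induct[of c ?S])
    show "Poly_Mapping.keys c \<subseteq> ?S"
      using that by simp
    show "\<exists>w\<in>words V. \<theta> w = 0"
      by (rule bexI[of _ "[]"]) (simp_all add: \<theta>_def)
    \<comment> \<open>The induction closes under differences, which are realized by appending the
      formal inverse of a word.\<close>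
    show "\<exists>w\<in>words V. \<theta> w = c - d"
      if cd: "\<exists>w\<in>words V. \<theta> w = c" "\<exists>w\<in>words V. \<theta> w = d" for c d
    proof -
      obtain u v where uv: "u \<in> words V" "\<theta> u = c" "v \<in> words V" "\<theta> v = d"
        using cd by blast
      have "\<theta> (inv_word w) = - \<theta> w" for w
        by (induction w) (auto simp: \<theta>_def sgn_def inv_word_def)
      then have "\<theta> (u @ inv_word v) = c - d"
        using uv by (simp add: \<theta>_def)
      with uv show ?thesis
        by (intro bexI[of _ "u @ inv_word v"]) simp_all
    qed
    show "\<exists>w\<in>words V. \<theta> w = frag_of g" if g: "g \<in> ?S" for g
    proof -
      obtain x where "x \<in> V" "g = ?gen x"
        using g by (auto simp: raag_generators_def)
      then show ?thesis
        by (intro bexI[of _ "[(x, False)]"]) (simp_all add: \<theta>_def sgn_def)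
    qed
  qed
  \<comment> \<open>Both arguments are values of \<theta> on words, which \<psi> sends to the
    classes of these words; equal classes have equal \<theta>.\<close>
  have "inj_on \<psi> (carrier ?F)"
  proof (rule inj_onI)
    fix c d assume "c \<in> carrier ?F" "d \<in> carrier ?F" and eq: "\<psi> c = \<psi> d"
    then obtain u v where uv: "u \<in> words V" "\<theta> u = c" "v \<in> words V" "\<theta> v = d"
      using \<theta>_surj[of c] \<theta>_surj[of d] by auto
    with eq have "raag_elem V E u = raag_elem V E v"
      using \<psi>\<theta>[of u] \<psi>\<theta>[of v] by simp
    then have "(u, v) \<in> raag_cong V E"
      using uv by (simp add: raag_elem_eq_iff)
    then show "c = d"
      using \<theta>_cong uv by auto
  qed
  moreover have "\<psi> ` carrier ?F = carrier (raag V E)"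
  proof
    show "carrier (raag V E) \<subseteq> \<psi> ` carrier ?F"
      using \<psi>\<theta> \<theta>_carrier by (auto elim!: raag_elemE) (metis imageI carrier_free_Abelian_group_iff)
  qed auto
  ultimately have "\<psi> \<in> iso ?F (raag V E)"
    using \<psi> by (simp add: iso_def bij_betw_def)
  then have "raag V E \<cong> ?F"
    by (intro group.iso_sym[OF group_free_Abelian_group] is_isoI)
  then show ?thesis
    unfolding free_abelian_def by blast
qed

theorem theorem4p12:
  fixes V :: "'v set" and E :: "'v set set"
  assumes "finite_simple_graph V E"
  shows "(\<not> free_abelian (raag V E) \<longrightarrow> conjugacy_ratio (raag V E) (raag_generators V E) = 0)
    \<and> (free_abelian (raag V E) \<longrightarrow> conjugacy_ratio (raag V E) (raag_generators V E) = 1)"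
proof (intro conjI impI)
  have fin: "finite V"
    using assms by (simp add: finite_simple_graph_def)
  show "conjugacy_ratio (raag V E) (raag_generators V E) = 0" if nonabelian: "\<not> free_abelian (raag V E)"
  proof -
    \<comment> \<open>If all distinct vertices were adjacent, the group would be free
      abelian.\<close>
    obtain x y where "x \<in> V" "y \<in> V" "x \<noteq> y" "\<not> adj E x y"
      using nonabelian raag_complete_free_abelian[of V E] by metis
    then show ?thesis
      by (rule conjugacy_ratio_nonadjacent[OF fin])
  qed
  show "conjugacy_ratio (raag V E) (raag_generators V E) = 1" if "free_abelian (raag V E)"
    using conjugacy_ratio_comm_group[OF free_abelian_imp_comm_group[OF group_raag that]]
      finite_word_ball_raag[OF fin] .
qed

end
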